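(* Let $\mathcal{F}$ be a family of numerical semigroups and let $\Delta$ be a numerical semigroup such that $S\subseteq\Delta$ for all $S\in\mathcal{F}$. Then there exists the smallest (with respect to inclusion of families) $R$-variety which contains $\mathcal{F}$ and with maximum equal to $\Delta$.
   Context: Let $\mathbb{N}$ be the set of nonnegative integers. A numerical semigroup is a subset $S\subseteq\mathbb{N}$ that is closed under addition, contains $0$, and has $\mathbb{N}\setminus S$ finite. If $S\subsetneq T$ are numerical semigroups, $\mathrm{F}_T(S)=\max(T\setminus S)$. An $R$-variety is a non-empty family $\mathcal{R}$ of numerical semigroups such that: (1) $\mathcal{R}$ has a maximum element with respect to inclusion, denoted $\Delta(\mathcal{R})$; (2) if $S,T\in\mathcal{R}$ then $S\cap T\in\mathcal{R}$; (3) if $S\in\mathcal{R}$ and $S\neq\Delta(\mathcal{R})$ then $S\cup\{\mathrm{F}_{\Delta(\mathcal{R})}(S)\}\in\mathcal{R}$. The maximum of $\mathcal{R}$ means $\Delta(\mathcal{R})$. *)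

theory Defs
  imports Main
begin

definition numerical_semigroup :: "nat set \<Rightarrow> bool" where
  "numerical_semigroup S \<longleftrightarrow>
     0 \<in> S \<and> (\<forall>x\<in>S. \<forall>y\<in>S. x + y \<in> S) \<and> finite (UNIV - S)"

text \<open>The Frobenius number of \<open>S\<close> restricted to \<open>T\<close>; meaningful when \<open>S \<subset> T\<close> are numerical
  semigroups, so that \<open>T - S\<close> is finite and non-empty.\<close>

definition rel_frobenius :: "nat set \<Rightarrow> nat set \<Rightarrow> nat" where
  "rel_frobenius T S = Max (T - S)"

text \<open>The maximum of a family with respect to inclusion; meaningful when the family has one,
  which \<open>R_variety\<close> below demands explicitly.\<close>

definition family_max :: "nat set set \<Rightarrow> nat set" where
  "family_max \<R> = (GREATEST T. T \<in> \<R>)"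

definition R_variety :: "nat set set \<Rightarrow> bool" where
  "R_variety \<R> \<longleftrightarrow>
     \<R> \<noteq> {} \<and>
     (\<forall>S\<in>\<R>. numerical_semigroup S) \<and>
     (\<exists>M\<in>\<R>. \<forall>S\<in>\<R>. S \<subseteq> M) \<and>
     (\<forall>S\<in>\<R>. \<forall>T\<in>\<R>. S \<inter> T \<in> \<R>) \<and>
     (\<forall>S\<in>\<R>. S \<noteq> family_max \<R> \<longrightarrow> S \<union> {rel_frobenius (family_max \<R>) S} \<in> \<R>)"

end

theory Submission
  imports Defs
begin

text \<open>Once the maximum \<open>\<Delta>\<close> is fixed, being an \<open>R\<close>-variety is a closure property: the family
  contains \<open>\<Delta>\<close>, consists of numerical subsemigroups of \<open>\<Delta>\<close>, and is closed under the two operations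
  \<open>(S, T) \<mapsto> S \<inter> T\<close> and \<open>S \<mapsto> S \<union> {F\<^sub>\<Delta>(S)}\<close> (\<open>R_variety_with_max_iff\<close>). Since neither operation
  depends on the family any more, such properties pass to intersections of non-empty collections of
  families. Hence the smallest \<open>R\<close>-variety is the intersection of all those containing \<open>\<F>\<close> with
  maximum \<open>\<Delta>\<close>; there is at least one to intersect, namely the family of all numerical semigroups
  contained in \<open>\<Delta>\<close> (\<open>R_variety_all_subsemigroups\<close>).\<close>

lemma family_max_eqI:
  assumes "\<Delta> \<in> \<R>" and "\<And>S. S \<in> \<R> \<Longrightarrow> S \<subseteq> \<Delta>"
  shows "family_max \<R> = \<Delta>"
  unfolding family_max_def using assms by (intro Greatest_equality) auto

text \<open>Two parts of the definition obstruct intersecting families: the maximum is only asserted to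
  exist, and \<open>family_max \<R>\<close> depends on \<open>\<R>\<close>. Fixing \<open>\<Delta>\<close> removes both, and every condition on the
  right-hand side is inherited by intersections of non-empty collections.\<close>

lemma R_variety_with_max_iff:
  "R_variety \<R> \<and> family_max \<R> = \<Delta> \<longleftrightarrow>
     \<Delta> \<in> \<R> \<and>
     (\<forall>S\<in>\<R>. numerical_semigroup S \<and> S \<subseteq> \<Delta>) \<and>
     (\<forall>S\<in>\<R>. \<forall>T\<in>\<R>. S \<inter> T \<in> \<R>) \<and>
     (\<forall>S\<in>\<R>. S \<noteq> \<Delta> \<longrightarrow> S \<union> {rel_frobenius \<Delta> S} \<in> \<R>)"
  (is "?L \<longleftrightarrow> ?R")
proof
  assume L: ?L
  then have R: "R_variety \<R>" and max: "family_max \<R> = \<Delta>"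
    by simp_all
  from R obtain M where M: "M \<in> \<R>" "\<forall>S\<in>\<R>. S \<subseteq> M"
    unfolding R_variety_def by (elim conjE bexE)
  then have "M = \<Delta>"
    using family_max_eqI[of M \<R>] max by simp
  with R M show ?R
    unfolding R_variety_def max by simp
next
  assume R: ?R
  then have max: "family_max \<R> = \<Delta>"
    by (intro family_max_eqI) simp_all
  from R have "\<Delta> \<in> \<R>" "\<forall>S\<in>\<R>. S \<subseteq> \<Delta>"
    by simp_all
  then have "\<R> \<noteq> {}" "\<exists>M\<in>\<R>. \<forall>S\<in>\<R>. S \<subseteq> M"
    by (metis empty_iff, metis)
  with R max show ?L
    unfolding R_variety_def max by simp
qed

lemma numerical_semigroup_Int:
  assumes "numerical_semigroup S" and "numerical_semigroup T"
  shows "numerical_semigroup (S \<inter> T)"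
  using assms unfolding numerical_semigroup_def by (auto simp: Diff_Int)

text \<open>Adjoining \<open>f = F\<^sub>T(S)\<close> preserves closure under addition because \<open>f\<close> is the last gap: for
  non-zero \<open>x\<close> the sum \<open>f + x\<close> is an element of \<open>T\<close> beyond \<open>f\<close>, hence lies in \<open>S\<close>.\<close>

lemma numerical_semigroup_insert_rel_frobenius:
  assumes S: "numerical_semigroup S" and T: "numerical_semigroup T" and "S \<subset> T"
  shows "numerical_semigroup (S \<union> {rel_frobenius T S})"
    and "rel_frobenius T S \<in> T"
proof -
  define f where "f = rel_frobenius T S"
  have "finite (UNIV - S)"
    using S unfolding numerical_semigroup_def by blast
  then have fin: "finite (T - S)"
    by (rule rev_finite_subset) auto
  moreover have "T - S \<noteq> {}"
    using \<open>S \<subset> T\<close> by blast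
  ultimately have f: "f \<in> T - S"
    unfolding f_def rel_frobenius_def by (rule Max_in)
  then show "rel_frobenius T S \<in> T"
    by (simp add: f_def)
  have beyond: "x \<in> S" if "x \<in> T" "f < x" for x
    using Max_ge[OF fin, of x] that unfolding f_def rel_frobenius_def by force
  have add_f: "f + x \<in> S \<union> {f}" if "x \<in> S \<union> {f}" for x
  proof (cases "x = 0")
    case False
    have "f + x \<in> T"
      using that f T \<open>S \<subset> T\<close> unfolding numerical_semigroup_def by blast
    with beyond[of "f + x"] False show ?thesis
      by simp
  qed simp
  have "x + y \<in> S \<union> {f}" if "x \<in> S \<union> {f}" "y \<in> S \<union> {f}" for x y
  proof (cases "x = f \<or> y = f")
    case True
    then show ?thesis
      using that add_f[of x] add_f[of y] by (metis add.commute)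
  next
    case False
    then show ?thesis
      using that S unfolding numerical_semigroup_def by blast
  qed
  moreover have "finite (UNIV - (S \<union> {f}))"
    using \<open>finite (UNIV - S)\<close> by (rule rev_finite_subset) auto
  ultimately have "numerical_semigroup (S \<union> {f})"
    using S unfolding numerical_semigroup_def by blast
  then show "numerical_semigroup (S \<union> {rel_frobenius T S})"
    by (simp add: f_def)
qed

lemma R_variety_all_subsemigroups:
  assumes "numerical_semigroup \<Delta>"
  defines "\<A> \<equiv> {S. numerical_semigroup S \<and> S \<subseteq> \<Delta>}"
  shows "R_variety \<A> \<and> family_max \<A> = \<Delta>"
proof -
  have "S \<inter> T \<in> \<A>" if "S \<in> \<A>" "T \<in> \<A>" for S T
    using that numerical_semigroup_Int unfolding \<A>_def by blast
  moreover have "S \<union> {rel_frobenius \<Delta> S} \<in> \<A>" if "S \<in> \<A>" "S \<noteq> \<Delta>" for S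
  proof -
    from that have "numerical_semigroup S" "S \<subset> \<Delta>"
      by (auto simp: \<A>_def)
    with numerical_semigroup_insert_rel_frobenius[OF _ assms(1)] show ?thesis
      by (simp add: \<A>_def)
  qed
  ultimately show ?thesis
    unfolding R_variety_with_max_iff using assms(1) by (simp add: \<A>_def)
qed

lemma R_variety_Inter:
  assumes "\<C> \<noteq> {}" and "\<And>\<W>. \<W> \<in> \<C> \<Longrightarrow> R_variety \<W> \<and> family_max \<W> = \<Delta>"
  shows "R_variety (\<Inter>\<C>) \<and> family_max (\<Inter>\<C>) = \<Delta>"
proof -
  from \<open>\<C> \<noteq> {}\<close> obtain \<W> where "\<W> \<in> \<C>"
    by blast
  with assms(2) have "\<forall>S\<in>\<Inter>\<C>. numerical_semigroup S \<and> S \<subseteq> \<Delta>"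
    unfolding R_variety_with_max_iff by (meson InterD)
  with assms(2) show ?thesis
    unfolding R_variety_with_max_iff by simp
qed

theorem proposition5p3:
  fixes \<F> :: "nat set set" and \<Delta> :: "nat set"
  assumes "\<forall>S\<in>\<F>. numerical_semigroup S"
    and "numerical_semigroup \<Delta>"
    and "\<forall>S\<in>\<F>. S \<subseteq> \<Delta>"
  shows "\<exists>\<V>. (R_variety \<V> \<and> \<F> \<subseteq> \<V> \<and> family_max \<V> = \<Delta>) \<and>
    (\<forall>\<W>. R_variety \<W> \<and> \<F> \<subseteq> \<W> \<and> family_max \<W> = \<Delta> \<longrightarrow> \<V> \<subseteq> \<W>)"
proof -
  define \<C> where "\<C> = {\<W>. R_variety \<W> \<and> \<F> \<subseteq> \<W> \<and> family_max \<W> = \<Delta>}"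
  have "{S. numerical_semigroup S \<and> S \<subseteq> \<Delta>} \<in> \<C>"
    unfolding \<C>_def using R_variety_all_subsemigroups[OF assms(2)] assms(1,3) by blast
  then have "R_variety (\<Inter>\<C>) \<and> family_max (\<Inter>\<C>) = \<Delta>"
    by (intro R_variety_Inter) (auto simp: \<C>_def)
  moreover have "\<F> \<subseteq> \<Inter>\<C>"
    by (auto simp: \<C>_def)
  moreover have "\<Inter>\<C> \<subseteq> \<W>" if "R_variety \<W> \<and> \<F> \<subseteq> \<W> \<and> family_max \<W> = \<Delta>" for \<W>
    using that by (auto simp: \<C>_def)
  ultimately show ?thesis
    by blast
qed

end
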